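(* For every integer $n>2$, let $C_n(123,231)$ denote the number of cyclic permutations of length $n$ that avoid both patterns $123$ and $231$. Then \[ C_n(123,231)=\begin{cases} \phi(2k)=\phi(n/2) & \text{if } n=4k,\\[2pt] \phi(k+1)+\phi(2k+1)=\phi\!\left(\frac{n+2}{4}\right)+\phi\!\left(\frac{n}{2}\right) & \text{if } n=4k+2,\\[2pt] \phi(m)=\phi\!\left(\frac{n+1}{2}\right) & \text{if } n=2m-1, \end{cases} \] where $k$ and $m$ denote positive integers and $\phi$ is Euler's totient function.
   Context: A permutation of length $n$ is a linear order $p=p_1p_2\cdots p_n$ of $[n]=\{1,\dots,n\}$, also viewed as the bijection $i\mapsto p_i$. It is cyclic if, as a bijection of $[n]$, it consists of a single cycle of length $n$. A permutation $p$ contains a pattern $q=q_1\cdots q_k$ if there are indices $i_1<\cdots<i_k$ such that for all $j,r$, $q_j<q_r$ iff $p_{i_j}<p_{i_r}$; otherwise $p$ avoids $q$. For a positive integer $z$, $\phi(z)$ is the number of integers in $\{1,\dots,z\}$ relatively prime to $z$. *)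

theory Defs
  imports "HOL-Combinatorics.Orbits" "HOL-Number_Theory.Totient"
begin

text \<open>
  A permutation \<open>p\<^sub>1 p\<^sub>2 \<dots> p\<^sub>n\<close> is a function \<open>p\<close> with \<open>p permutes {1..n}\<close>, its entries being
  \<open>p\<^sub>i = p i\<close>. A pattern is given in one-line notation as a list, so its positions are
  counted from 0.
\<close>

definition contains_pattern :: "nat \<Rightarrow> (nat \<Rightarrow> nat) \<Rightarrow> nat list \<Rightarrow> bool" where
  "contains_pattern n p q \<longleftrightarrow>
     (\<exists>i :: nat \<Rightarrow> nat.
        strict_mono_on {..<length q} i \<and>
        (\<forall>j<length q. i j \<in> {1..n}) \<and>
        (\<forall>j<length q. \<forall>r<length q. q ! j < q ! r \<longleftrightarrow> p (i j) < p (i r)))"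

definition avoids_pattern :: "nat \<Rightarrow> (nat \<Rightarrow> nat) \<Rightarrow> nat list \<Rightarrow> bool" where
  "avoids_pattern n p q \<longleftrightarrow> \<not> contains_pattern n p q"

definition cyclic_permutation :: "nat \<Rightarrow> (nat \<Rightarrow> nat) \<Rightarrow> bool" where
  "cyclic_permutation n p \<longleftrightarrow> p permutes {1..n} \<and> cyclic_on p {1..n}"

definition num_cyclic_avoiding :: "nat \<Rightarrow> nat list set \<Rightarrow> nat" where
  "num_cyclic_avoiding n Q = card {p. cyclic_permutation n p \<and> (\<forall>q\<in>Q. avoids_pattern n p q)}"

end

theory Submission
  imports Defs
begin

text \<open>
  Let \<open>p\<close> avoid both patterns and let \<open>t\<close> be the position of the entry 1. The entries before
  \<open>t\<close> decrease (no 231), the entries after \<open>t\<close> decrease (no 123), and an entry before \<open>t\<close> cannot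
  lie between two entries after \<open>t\<close> (no 231). Counting, for every \<open>i\<close>, the entries greater than
  \<open>p i\<close> shows that \<open>p\<close> is the decreasing permutation with its last \<open>N\<close> entries cyclically rotated
  by some \<open>d < N\<close>. Let \<open>c = n - N\<close>.

  If \<open>c > N\<close> then \<open>p\<close> has a cycle of length at most 2. Otherwise \<open>p\<close> sends \<open>{1..c}\<close> into
  \<open>{c+1..n}\<close>, and the first return map to \<open>{c+1..n}\<close> is the rotation by \<open>d\<close> of the integers
  modulo \<open>N\<close>, followed by the reversal of the first \<open>e = N - c\<close> residues. This map is conjugated
  to its inverse by the involution that fixes \<open>0, \<dots>, e - 1\<close> and reverses the other residues.
  An involution inverting an \<open>N\<close>-cycle acts as a reflection of an \<open>N\<close>-gon and fixes at most
  two points, so \<open>e \<le> 2\<close>. For \<open>e \<le> 1\<close> the return map is the rotation itself, which is cyclic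
  iff \<open>gcd d N = 1\<close>. For \<open>e = 2\<close> it is the rotation followed by a transposition of two adjacent
  residues, which splits a single cycle and merges two cycles, so it is cyclic iff
  \<open>gcd d N = 2\<close>. Since \<open>n = 2 * N - e\<close>, the residue of \<open>n\<close> modulo 4 decides which \<open>e\<close> contribute.
\<close>

section \<open>Cyclic permutations\<close>

lemma orbit_subset_closed:
  assumes "f ` T \<subseteq> T" "x \<in> T"
  shows "orbit f x \<subseteq> T"
proof
  fix y assume "y \<in> orbit f x"
  then show "y \<in> T" by induction (use assms in auto)
qed

lemma cyclic_on_iff_orbit_eq:
  assumes "x \<in> S"
  shows "cyclic_on f S \<longleftrightarrow> orbit f x = S"
  using assms by (metis cyclic_on_singleI orbit_cyclic_eq3)

lemma cyclic_on_image_iff: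
  assumes "inj_on h S" "f ` S \<subseteq> S" "\<And>x. x \<in> S \<Longrightarrow> g (h x) = h (f x)"
  shows "cyclic_on g (h ` S) \<longleftrightarrow> cyclic_on f S"
proof
  assume "cyclic_on g (h ` S)"
  moreover have "f (inv_into S h y) = inv_into S h (g y)" if "y \<in> h ` S" for y
    using that assms by (auto simp: image_subset_iff)
  ultimately have "cyclic_on f (inv_into S h ` h ` S)"
    by (rule cyclic_on_image)
  then show "cyclic_on f S"
    using assms(1) by simp
qed (rule cyclic_on_image, use assms in auto)

text \<open>This is the first return map to \<open>A\<close> only if \<open>f\<close> sends the complement of \<open>A\<close> into \<open>A\<close>.\<close>

definition return_map :: "('a \<Rightarrow> 'a) \<Rightarrow> 'a set \<Rightarrow> 'a \<Rightarrow> 'a" where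
  "return_map f A x = (if f x \<in> A then f x else f (f x))"

lemma orbit_return_map:
  assumes "f ` S \<subseteq> S" "A \<subseteq> S" "f ` (S - A) \<subseteq> A" "a \<in> A"
  shows "orbit (return_map f A) a = orbit f a \<inter> A"
proof
  have closed: "return_map f A x \<in> A" if "x \<in> A" for x
    using assms that by (auto simp: return_map_def)
  have "y \<in> orbit f a \<inter> A" if "y \<in> orbit (return_map f A) a" for y
    using that
  proof induction
    case base
    then show ?case
      using closed[OF \<open>a \<in> A\<close>] by (auto simp: return_map_def[of f A a] intro: orbit.intros)
  next
    case (step y)
    then show ?case
      using closed[of y] by (auto simp: return_map_def[of f A y] intro: orbit.intros)
  qed
  then show "orbit (return_map f A) a \<subseteq> orbit f a \<inter> A" by blast
next
  have "y \<in> S \<and> (if y \<in> A then y else f y) \<in> orbit (return_map f A) a" if "y \<in> orbit f a" for y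
    using that
  proof induction
    case base
    then show ?case
      using orbit.base[of "return_map f A" a] assms by (auto simp: return_map_def[of f A a])
  next
    case (step y)
    show ?case
    proof (cases "y \<in> A")
      case True
      then show ?thesis
        using orbit.step[of y "return_map f A" a] step assms
        by (auto simp: return_map_def[of f A y])
    next
      case False
      then show ?thesis using step assms by auto
    qed
  qed
  then show "orbit f a \<inter> A \<subseteq> orbit (return_map f A) a" by (metis IntE subsetI)
qed

lemma cyclic_on_return_map_iff:
  assumes "f permutes S" "finite S" "A \<subseteq> S" "f ` (S - A) \<subseteq> A"
  shows "cyclic_on (return_map f A) A \<longleftrightarrow> cyclic_on f S"
proof (cases "A = {}")
  case True
  then have "S = {}" using assms by auto
  with True show ?thesis by (simp add: cyclic_on_def)
next
  case False
  then obtain a where "a \<in> A" by blast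
  have "f ` S \<subseteq> S" using permutes_image[OF assms(1)] by simp
  then have orbit: "orbit (return_map f A) a = orbit f a \<inter> A"
    using assms \<open>a \<in> A\<close> by (intro orbit_return_map)
  have "permutation f" using assms permutation_permutes by blast
  have "a \<in> S" using \<open>a \<in> A\<close> assms(3) by blast
  then have "orbit f a \<subseteq> S" by (rule permutes_orbit_subset[OF assms(1)])
  moreover have "S \<subseteq> orbit f a" if "A \<subseteq> orbit f a"
  proof
    fix x assume "x \<in> S"
    then consider "x \<in> A" | "f x \<in> A" using assms by blast
    then show "x \<in> orbit f a"
    proof cases
      case 2
      then have "f x \<in> orbit f a" using that by blast
      then have "orbit f (f x) = orbit f a"
        by (rule orbit_cyclic_eq3[OF cyclic_on_orbit'[OF \<open>permutation f\<close>]])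
      then show ?thesis
        using \<open>permutation f\<close> permutation_self_in_orbit[of f x] permutation_orbit_step[of f x]
        by simp
    qed (use that in blast)
  qed
  ultimately have "orbit f a \<inter> A = A \<longleftrightarrow> orbit f a = S"
    using assms(3) by (metis Int_absorb1 Int_lower1 subset_antisym)
  then show ?thesis
    using \<open>a \<in> A\<close> \<open>a \<in> S\<close> by (simp add: cyclic_on_iff_orbit_eq orbit)
qed

lemma cyclic_on_card_eq_funpow_dist1:
  assumes "cyclic_on f S" "x \<in> S"
  shows "card S = funpow_dist1 f x x"
proof -
  have "S = orbit f x" using orbit_cyclic_eq3[OF assms] ..
  moreover from this assms have "x \<in> orbit f x" by simp
  ultimately show ?thesis
    using card_image[OF inj_on_funpow_dist1, of x f x] orbit_conv_funpow_dist1[of x f] by simp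
qed

lemma cyclic_on_funpow_eq_self_iff:
  assumes "cyclic_on f S" "x \<in> S"
  shows "(f ^^ m) x = x \<longleftrightarrow> card S dvd m"
proof -
  have card: "card S = funpow_dist1 f x x" by (rule cyclic_on_card_eq_funpow_dist1[OF assms])
  have "(f ^^ card S) x = x"
    unfolding card using orbit_cyclic_eq3[OF assms] assms by (intro funpow_dist1_prop) simp
  then have "(f ^^ m) x = (f ^^ (m mod card S)) x" by (rule funpow_mod_eq[symmetric])
  moreover have "(f ^^ (m mod card S)) x \<noteq> x" if "m mod card S \<noteq> 0"
    using that unfolding card by (intro funpow_dist1_least) simp_all
  ultimately show ?thesis by (metis dvd_eq_mod_eq_0 funpow_0)
qed

lemma cyclic_on_funpow_reach:
  assumes "cyclic_on f S" "x \<in> S" "y \<in> S"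
  obtains k where "k < card S" "(f ^^ k) x = y"
proof -
  have "orbit f x = S" by (rule orbit_cyclic_eq3[OF assms(1,2)])
  then have "y \<in> (\<lambda>k. (f ^^ k) x) ` {0..<card S}"
    using orbit_conv_funpow_dist1[of x f] cyclic_on_card_eq_funpow_dist1[OF assms(1,2)] assms
    by simp
  then show ?thesis using that by auto
qed

text \<open>The condition \<open>f (g (f x)) = g x\<close> says that \<open>g\<close> conjugates \<open>f\<close> to its inverse.\<close>

lemma card_fixpoints_reversor_le_2:
  assumes cyclic: "cyclic_on f S"
    and reversor: "\<And>x. x \<in> S \<Longrightarrow> f (g (f x)) = g x"
  shows "card {x \<in> S. g x = x} \<le> 2"
proof (cases "{x \<in> S. g x = x} = {}")
  case False
  then obtain x where fixed_x: "x \<in> S" "g x = x" by blast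
  have reversor_funpow: "(f ^^ k) (g ((f ^^ k) x)) = g x" for k
  proof (induction k)
    case (Suc k)
    have "(f ^^ Suc k) (g ((f ^^ Suc k) x)) = (f ^^ k) (f (g (f ((f ^^ k) x))))"
      by (simp add: funpow_swap1)
    then show ?case
      using Suc reversor cyclic_on_funpow_in[OF cyclic fixed_x(1)] by simp
  qed simp
  have "y \<in> {x, (f ^^ (card S div 2)) x}" if fixed_y: "y \<in> S" "g y = y" for y
  proof -
    obtain k where "k < card S" and reach: "(f ^^ k) x = y"
      using cyclic_on_funpow_reach[OF cyclic fixed_x(1) fixed_y(1)] .
    have "(f ^^ (2 * k)) x = x"
      using reversor_funpow[of k] reach fixed_x fixed_y by (simp add: mult_2 funpow_add)
    then have "card S dvd 2 * k"
      using cyclic_on_funpow_eq_self_iff[OF cyclic fixed_x(1)] by blast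
    then obtain q where double: "2 * k = card S * q" by blast
    then have "card S * q < card S * 2" using \<open>k < card S\<close> by linarith
    then have "q < 2" by simp
    then have "k = 0 \<or> k = card S div 2" using double by (auto simp: less_2_cases_iff)
    then show ?thesis using reach by auto
  qed
  then have "{x \<in> S. g x = x} \<subseteq> {x, (f ^^ (card S div 2)) x}" by blast
  then have "card {x \<in> S. g x = x} \<le> card {x, (f ^^ (card S div 2)) x}"
    by (intro card_mono) simp_all
  also have "\<dots> \<le> 2" by (simp add: card_insert_if)
  finally show ?thesis .
qed (simp only: card.empty zero_le)

lemma transpose_comp_splits_orbit:
  assumes "b \<in> orbit f a" "a \<noteq> b"
  shows "b \<notin> orbit (transpose a b \<circ> f) a"
proof -
  define k where "k = funpow_dist f a b"
  define T where "T = (\<lambda>i. (f ^^ i) a) ` {..<k}"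
  have "k > 0" using funpow_dist_0_eq[OF assms(1)] assms(2) by (simp add: k_def)
  then have "a \<in> T" by (auto simp: T_def intro: image_eqI[of _ _ 0])
  have "b \<notin> T" by (auto simp: T_def k_def dest: funpow_dist_least)
  have "transpose a b (f x) \<in> T" if x: "x \<in> T" for x
  proof -
    obtain i where "i < k" and f_x: "f x = (f ^^ Suc i) a" using x by (auto simp: T_def)
    show ?thesis
    proof (cases "Suc i = k")
      case True
      then have "f x = b" using f_x funpow_dist_prop[OF assms(1)] by (simp add: k_def)
      then show ?thesis using \<open>a \<in> T\<close> by simp
    next
      case False
      then have "Suc i < k" using \<open>i < k\<close> by simp
      then have "f x \<in> T" unfolding f_x T_def by (intro imageI) simp
      moreover have "f x \<noteq> a"
        using funpow_neq_less_funpow_dist[OF assms(1), of "Suc i" 0] \<open>Suc i < k\<close> f_x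
        by (simp add: k_def)
      ultimately show ?thesis using \<open>b \<notin> T\<close> by (metis transpose_apply_other)
    qed
  qed
  then have "orbit (transpose a b \<circ> f) a \<subseteq> T"
    using \<open>a \<in> T\<close> by (intro orbit_subset_closed) auto
  then show ?thesis using \<open>b \<notin> T\<close> by blast
qed

lemma transpose_comp_merges_orbit:
  assumes "permutation f" "b \<notin> orbit f a"
  shows "insert b (orbit f a) \<subseteq> orbit (transpose a b \<circ> f) a"
proof -
  let ?g = "transpose a b \<circ> f"
  have self: "a \<in> orbit ?g a"
    using assms(1) by (intro permutation_self_in_orbit permutation_compose permutation_swap_id)
  have f_step: "f y \<in> orbit ?g a \<and> (f y = a \<longrightarrow> b \<in> orbit ?g a)"
    if "f y \<noteq> b" "?g y \<in> orbit ?g a" for y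
    using that self by (cases "f y = a") auto
  have "y \<in> orbit ?g a \<and> (y = a \<longrightarrow> b \<in> orbit ?g a)" if "y \<in> orbit f a" for y
    using that
  proof induction
    case base
    have "f a \<noteq> b" using assms(2) orbit.base[of f a] by metis
    then show ?case using orbit.base by (rule f_step)
  next
    case (step y)
    have "f y \<noteq> b" using assms(2) orbit.step[OF step.hyps] by metis
    moreover have "?g y \<in> orbit ?g a" using step.IH by (intro orbit.step) simp
    ultimately show ?case by (rule f_step)
  qed
  then show ?thesis using permutation_self_in_orbit[OF assms(1), of a] by blast
qed

lemma cyclic_on_transpose_comp_iff:
  assumes perm: "f permutes S" and "finite S" and ab: "a \<in> S" "b \<in> S" "a \<noteq> b"
  shows "cyclic_on (transpose a b \<circ> f) S \<longleftrightarrow> b \<notin> orbit f a \<and> S = orbit f a \<union> orbit f b"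
proof -
  let ?g = "transpose a b \<circ> f" and ?U = "orbit f a \<union> orbit f b"
  have "permutation f" using perm \<open>finite S\<close> permutation_permutes by blast
  then have self: "x \<in> orbit f x" for x by (rule permutation_self_in_orbit)
  have g_permutes: "?g permutes S"
    using perm permutes_swap_id[OF ab(1,2)] by (intro permutes_compose)
  have cyclic_iff: "cyclic_on ?g S \<longleftrightarrow> orbit ?g a = S"
    using ab(1) by (rule cyclic_on_iff_orbit_eq)
  show ?thesis
  proof (intro iffI conjI)
    assume "cyclic_on ?g S"
    then have orbit_g: "orbit ?g a = S" unfolding cyclic_iff .
    then have "b \<notin> orbit (transpose a b \<circ> ?g) a"
      using ab by (intro transpose_comp_splits_orbit) simp_all
    then show "b \<notin> orbit f a" by (simp flip: comp_assoc)
    have "f y \<in> ?U" if "y \<in> ?U" for y using that orbit.step by fast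
    then have "orbit ?g a \<subseteq> ?U"
      using self by (intro orbit_subset_closed) (auto simp: transpose_def)
    then show "S = ?U"
      using orbit_g permutes_orbit_subset[OF perm] ab by blast
  next
    assume split: "b \<notin> orbit f a \<and> S = ?U"
    then have a_part: "insert b (orbit f a) \<subseteq> orbit ?g a"
      using \<open>permutation f\<close> by (intro transpose_comp_merges_orbit) auto
    have "a \<notin> orbit f b" using split self orbit_swap by metis
    then have "insert a (orbit f b) \<subseteq> orbit ?g b"
      using transpose_comp_merges_orbit[OF \<open>permutation f\<close>, of a b]
      by (simp add: transpose_commute)
    moreover have "orbit ?g b = orbit ?g a"
      using a_part orbit_cyclic_eq3[OF cyclic_on_orbit[OF g_permutes \<open>finite S\<close>]] by blast
    ultimately have "orbit ?g a = S"
      using split a_part permutes_orbit_subset[OF g_permutes ab(1)] by blast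
    then show "cyclic_on ?g S" unfolding cyclic_iff .
  qed
qed

section \<open>Rotations composed with reversals\<close>

definition rotate_below :: "nat \<Rightarrow> nat \<Rightarrow> nat \<Rightarrow> nat" where
  "rotate_below N d x = (if x < N then (x + d) mod N else x)"

definition reverse_below :: "nat \<Rightarrow> nat \<Rightarrow> nat" where
  "reverse_below e x = (if x < e then e - 1 - x else x)"

lemma rotate_below_less: "x < N \<Longrightarrow> rotate_below N d x < N"
  by (simp add: rotate_below_def)

lemma rotate_below_eq_if:
  "x < N \<Longrightarrow> d < N \<Longrightarrow> rotate_below N d x = (if x + d < N then x + d else x + d - N)"
  by (simp add: rotate_below_def mod_if)

lemma rotate_below_permutes: "rotate_below N d permutes {..<N}"
proof (rule inj_imp_permutes)
  show "inj_on (rotate_below N d) {..<N}"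
  proof (rule inj_onI)
    fix x y assume "x \<in> {..<N}" "y \<in> {..<N}" and "rotate_below N d x = rotate_below N d y"
    then have "x < N" "y < N" "[x + d = y + d] (mod N)"
      by (simp_all add: rotate_below_def cong_def)
    then show "x = y" by (simp add: cong_add_rcancel_nat cong_less_modulus_unique_nat)
  qed
qed (auto simp: rotate_below_def)

lemma reverse_below_reverse_below: "reverse_below e (reverse_below e x) = x"
  by (auto simp: reverse_below_def)

lemma reverse_below_eq_id: "e \<le> 1 \<Longrightarrow> reverse_below e = id"
  by (auto simp: reverse_below_def)

lemma reverse_below_2_eq_transpose: "reverse_below 2 = transpose 0 1"
  by (auto simp: reverse_below_def transpose_def)

lemma funpow_rotate_below:
  "x < N \<Longrightarrow> (rotate_below N d ^^ k) x = (x + k * d) mod N"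
  by (induction k) (simp_all add: rotate_below_def mod_simps add_ac)

lemma orbit_rotate_below:
  assumes "x < N"
  shows "orbit (rotate_below N d) x = {y. y < N \<and> [y = x] (mod gcd d N)}"
proof -
  have "permutation (rotate_below N d)"
    using rotate_below_permutes permutation_permutes by blast
  then have orbit: "orbit (rotate_below N d) x = {(rotate_below N d ^^ k) x | k. True}"
    by (rule orbit_altdef_permutation)
  show ?thesis
  proof (intro equalityI subsetI)
    fix y assume "y \<in> orbit (rotate_below N d) x"
    then obtain k where y_eq: "y = (x + k * d) mod N"
      using assms orbit by (auto simp: funpow_rotate_below)
    then have "[y = x + k * d] (mod gcd d N)"
      by (metis cong_dvd_modulus_nat cong_mod_left cong_refl gcd_dvd2)
    moreover have "[x + k * d = x] (mod gcd d N)"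
      by (simp add: cong_add_lcancel_0_nat cong_0_iff)
    ultimately show "y \<in> {y. y < N \<and> [y = x] (mod gcd d N)}"
      using y_eq assms cong_trans by auto
  next
    fix y assume "y \<in> {y. y < N \<and> [y = x] (mod gcd d N)}"
    then have "y < N" and cong: "[y = x] (mod gcd d N)" by auto
    have "[x + (y + N - x) = x + 0] (mod gcd d N)"
      using cong assms by (auto simp: cong_def mod_add_right_eq[symmetric, of y N])
    then have "gcd d N dvd y + N - x"
      by (simp only: cong_add_lcancel_nat cong_0_iff)
    then obtain k where "[d * k = y + N - x] (mod N)"
      using cong_solve_dvd_nat by blast
    then have "[x + d * k = x + (y + N - x)] (mod N)"
      by (intro cong_add) auto
    then have "(rotate_below N d ^^ k) x = y"
      using assms \<open>y < N\<close> by (simp add: funpow_rotate_below cong_def mult.commute)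
    then show "y \<in> orbit (rotate_below N d) x"
      using orbit by blast
  qed
qed

lemma cyclic_on_rotate_below_iff:
  assumes "N > 0"
  shows "cyclic_on (rotate_below N d) {..<N} \<longleftrightarrow> coprime d N"
proof -
  have "cyclic_on (rotate_below N d) {..<N} \<longleftrightarrow> {y. y < N \<and> gcd d N dvd y} = {..<N}"
    using assms cyclic_on_iff_orbit_eq[of 0 "{..<N}" "rotate_below N d"]
    by (simp add: orbit_rotate_below cong_0_iff)
  also have "\<dots> \<longleftrightarrow> gcd d N = 1"
  proof
    assume "{y. y < N \<and> gcd d N dvd y} = {..<N}"
    then have "N > 1 \<Longrightarrow> gcd d N dvd 1" by blast
    then show "gcd d N = 1" using assms by (cases "N = 1") auto
  qed auto
  finally show ?thesis by (simp add: coprime_iff_gcd_eq_1)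
qed

lemma cyclic_on_transpose_rotate_below_iff:
  assumes "N \<ge> 2"
  shows "cyclic_on (transpose 0 1 \<circ> rotate_below N d) {..<N} \<longleftrightarrow> gcd d N = 2"
proof -
  define h where "h = gcd d N"
  have "h > 0" "h \<le> N" using assms by (auto simp: h_def)
  have "cyclic_on (transpose 0 1 \<circ> rotate_below N d) {..<N} \<longleftrightarrow>
      \<not> [1 = 0] (mod h) \<and>
      {..<N} = {y. y < N \<and> [y = 0] (mod h)} \<union> {y. y < N \<and> [y = 1] (mod h)}"
    (is "_ \<longleftrightarrow> ?split")
    using assms
    by (subst cyclic_on_transpose_comp_iff[OF rotate_below_permutes])
      (simp_all add: orbit_rotate_below h_def)
  also have "?split \<longleftrightarrow> h = 2"
  proof
    assume split: ?split
    then have "h \<noteq> 1" by (auto simp: cong_def)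
    moreover have "h \<le> 2"
    proof (rule ccontr)
      assume "\<not> h \<le> 2"
      then have "2 < N" using \<open>h \<le> N\<close> by simp
      then have "[2 = 0] (mod h) \<or> [2 = 1] (mod h)" using split by blast
      then show False using \<open>\<not> h \<le> 2\<close> by (simp add: cong_def)
    qed
    ultimately show "h = 2" using \<open>h > 0\<close> by linarith
  next
    assume "h = 2"
    then show ?split by (auto simp: cong_def)
  qed
  finally show ?thesis by (simp only: h_def)
qed

lemma cyclic_on_reverse_rotate_below_le_2:
  assumes cyclic: "cyclic_on (reverse_below e \<circ> rotate_below N d) {..<N}"
    and "d < N" "e \<le> N"
  shows "e \<le> 2"
proof -
  define reflect where "reflect x = (if x < e then e - 1 - x else N + e - 1 - x)" for x
  define reversor where "reversor = reverse_below e \<circ> reflect"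
  have reverse_reflect: "reverse_below e (reflect x) = reflect (reverse_below e x)"
    if "x < N" for x
    using that by (auto simp: reflect_def reverse_below_def)
  have rotate_reflect: "rotate_below N d (reflect (rotate_below N d x)) = reflect x"
    if "x < N" for x
  proof -
    have "reflect x < N" "reflect (rotate_below N d x) < N"
      using that assms(2,3) by (auto simp: reflect_def rotate_below_eq_if)
    then show ?thesis
      using that assms(2,3) by (auto simp: rotate_below_eq_if reflect_def split: if_splits)
  qed
  have "(reverse_below e \<circ> rotate_below N d)
      (reversor ((reverse_below e \<circ> rotate_below N d) x)) = reversor x" if "x < N" for x
    using that rotate_below_less[OF that, of d]
    by (simp add: reversor_def reverse_below_reverse_below rotate_reflect flip: reverse_reflect)
  then have "card {x \<in> {..<N}. reversor x = x} \<le> 2"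
    by (intro card_fixpoints_reversor_le_2[OF cyclic]) simp
  moreover have "{..<e} \<subseteq> {x \<in> {..<N}. reversor x = x}"
    using assms(3) by (auto simp: reversor_def reflect_def reverse_below_def)
  then have "card {..<e} \<le> card {x \<in> {..<N}. reversor x = x}"
    by (intro card_mono) simp_all
  ultimately show ?thesis by simp
qed

lemma cyclic_on_reverse_rotate_below_iff:
  assumes "d < N" "e \<le> N"
  shows "cyclic_on (reverse_below e \<circ> rotate_below N d) {..<N} \<longleftrightarrow>
    e \<le> 1 \<and> coprime d N \<or> e = 2 \<and> gcd d N = 2"
proof -
  consider "e \<le> 1" | "e = 2" | "e > 2" by linarith
  then show ?thesis
  proof cases
    case 1
    then show ?thesis
      using assms by (simp add: reverse_below_eq_id cyclic_on_rotate_below_iff)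
  next
    case 2
    then show ?thesis
      using assms cyclic_on_transpose_rotate_below_iff[of N d]
      by (simp add: reverse_below_2_eq_transpose)
  next
    case 3
    then show ?thesis
      using cyclic_on_reverse_rotate_below_le_2[of e N d] assms by auto
  qed
qed

section \<open>Rotated reversals\<close>

definition rotated_reversal :: "nat \<Rightarrow> nat \<Rightarrow> nat \<Rightarrow> nat \<Rightarrow> nat" where
  "rotated_reversal c N d i =
     (if i = 0 \<or> c + N < i then i
      else if i \<le> c then c + N + 1 - i
      else N - rotate_below N d (i - (c + 1)))"

lemma rotated_reversal_low:
  "0 < i \<Longrightarrow> i \<le> c \<Longrightarrow> rotated_reversal c N d i = c + N + 1 - i"
  by (simp add: rotated_reversal_def)

lemma rotated_reversal_high:
  "x < N \<Longrightarrow> rotated_reversal c N d (c + 1 + x) = N - rotate_below N d x"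
  by (simp add: rotated_reversal_def)

lemma rotated_reversal_eq_if:
  assumes "d < N" "0 < i" "i \<le> c + N"
  shows "rotated_reversal c N d i =
    (if i \<le> c then c + N + 1 - i
     else if i + d \<le> c + N then c + N + 1 - d - i
     else c + 2 * N + 1 - d - i)"
proof (cases "i \<le> c")
  case False
  then show ?thesis
    using assms rotate_below_eq_if[of "i - (c + 1)" N d] by (auto simp: rotated_reversal_def)
qed (use assms in \<open>simp add: rotated_reversal_low\<close>)

lemma rotated_reversal_permutes:
  assumes "d < N"
  shows "rotated_reversal c N d permutes {1..c + N}"
proof (rule inj_imp_permutes)
  show "inj_on (rotated_reversal c N d) {1..c + N}"
    by (rule inj_onI) (use assms in \<open>auto simp: rotated_reversal_eq_if split: if_splits\<close>)
  show "rotated_reversal c N d i \<in> {1..c + N}" if "i \<in> {1..c + N}" for i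
    using that assms by (auto simp: rotated_reversal_eq_if)
qed (auto simp: rotated_reversal_def)

lemma cyclic_on_rotated_reversal_imp_le:
  assumes "cyclic_on (rotated_reversal c N d) {1..c + N}" "c + N > 2"
  shows "c \<le> N"
proof (rule ccontr)
  assume "\<not> c \<le> N"
  then have "(rotated_reversal c N d ^^ 2) c = c"
    by (simp add: numeral_2_eq_2 rotated_reversal_low)
  moreover have "c \<in> {1..c + N}" using \<open>\<not> c \<le> N\<close> by simp
  ultimately have "card {1..c + N} dvd 2"
    using cyclic_on_funpow_eq_self_iff[OF assms(1)] by blast
  then show False using assms(2) by (auto dest: dvd_imp_le)
qed

lemma return_map_rotated_reversal:
  assumes "c \<le> N" "x < N"
  shows "return_map (rotated_reversal c N d) {c + 1..c + N} (c + 1 + x) =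
    c + 1 + reverse_below (N - c) (rotate_below N d x)"
proof -
  define y where "y = rotate_below N d x"
  have "y < N" using assms by (simp add: y_def rotate_below_less)
  have first: "rotated_reversal c N d (c + 1 + x) = N - y"
    unfolding y_def by (rule rotated_reversal_high) fact
  show ?thesis
  proof (cases "y < N - c")
    case True
    then show ?thesis
      unfolding return_map_def first by (auto simp: reverse_below_def simp flip: y_def)
  next
    case False
    then have "rotated_reversal c N d (N - y) = c + 1 + y"
      using \<open>y < N\<close> by (subst rotated_reversal_low) auto
    then show ?thesis
      unfolding return_map_def first using False \<open>y < N\<close>
      by (auto simp: reverse_below_def simp flip: y_def)
  qed
qed

lemma cyclic_on_rotated_reversal_iff_reverse_rotate:
  assumes "d < N" "c \<le> N"
  shows "cyclic_on (rotated_reversal c N d) {1..c + N} \<longleftrightarrow>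
    cyclic_on (reverse_below (N - c) \<circ> rotate_below N d) {..<N}"
proof -
  let ?p = "rotated_reversal c N d" and ?A = "{c + 1..c + N}"
  let ?r = "reverse_below (N - c) \<circ> rotate_below N d"
  have shift: "(+) (c + 1) ` {..<N} = ?A"
    unfolding lessThan_atLeast0 image_add_atLeastLessThan by auto
  have "?p ` ({1..c + N} - ?A) \<subseteq> ?A"
    using assms by (auto simp: rotated_reversal_low)
  then have "cyclic_on ?p {1..c + N} \<longleftrightarrow> cyclic_on (return_map ?p ?A) ?A"
    using rotated_reversal_permutes[OF assms(1)]
    by (intro cyclic_on_return_map_iff[symmetric]) auto
  also have "\<dots> \<longleftrightarrow> cyclic_on (return_map ?p ?A) ((+) (c + 1) ` {..<N})"
    by (simp only: shift)
  also have "\<dots> \<longleftrightarrow> cyclic_on ?r {..<N}"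
  proof (rule cyclic_on_image_iff)
    show "?r ` {..<N} \<subseteq> {..<N}"
      using rotate_below_less[of _ N d] by (fastforce simp: reverse_below_def)
    show "return_map ?p ?A (c + 1 + x) = c + 1 + ?r x" if "x \<in> {..<N}" for x
      using return_map_rotated_reversal assms that by simp
  qed simp
  finally show ?thesis .
qed

lemma cyclic_on_rotated_reversal_iff:
  assumes "d < N" "c + N > 2"
  shows "cyclic_on (rotated_reversal c N d) {1..c + N} \<longleftrightarrow>
    (N = c \<or> N = c + 1) \<and> coprime d N \<or> N = c + 2 \<and> gcd d N = 2"
proof (cases "c \<le> N")
  case True
  then have "N - c \<le> 1 \<longleftrightarrow> N = c \<or> N = c + 1" "N - c = 2 \<longleftrightarrow> N = c + 2" by auto
  then show ?thesis
    unfolding cyclic_on_rotated_reversal_iff_reverse_rotate[OF assms(1) True]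
      cyclic_on_reverse_rotate_below_iff[OF assms(1) diff_le_self] by auto
next
  case False
  then show ?thesis using cyclic_on_rotated_reversal_imp_le[of c N d] assms by auto
qed

section \<open>Permutations avoiding 123 and 231\<close>

lemma contains_pattern_length_3:
  "contains_pattern n p [a, b, c] \<longleftrightarrow>
     (\<exists>i j k. 0 < i \<and> i < j \<and> j < k \<and> k \<le> n \<and>
        (a < b \<longleftrightarrow> p i < p j) \<and> (b < a \<longleftrightarrow> p j < p i) \<and>
        (a < c \<longleftrightarrow> p i < p k) \<and> (c < a \<longleftrightarrow> p k < p i) \<and>
        (b < c \<longleftrightarrow> p j < p k) \<and> (c < b \<longleftrightarrow> p k < p j))"
    (is "_ \<longleftrightarrow> (\<exists>i j k. ?occurs i j k)")
proof
  assume "contains_pattern n p [a, b, c]"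
  then obtain f where embedding: "strict_mono_on {..<3} f" "\<forall>j<3. f j \<in> {1..n}"
    "\<forall>j<3. \<forall>r<3. [a, b, c] ! j < [a, b, c] ! r \<longleftrightarrow> p (f j) < p (f r)"
    by (auto simp: contains_pattern_def numeral_3_eq_3)
  have "f 0 < f 1" "f 1 < f 2" using embedding(1) by (auto simp: strict_mono_on_def)
  moreover have "0 < f 0" "f 2 \<le> n"
    using embedding(2)[rule_format, of 0] embedding(2)[rule_format, of 2] by auto
  ultimately have "?occurs (f 0) (f 1) (f 2)"
    using embedding(3) by (auto simp: numeral_3_eq_3 numeral_2_eq_2 All_less_Suc)
  then show "\<exists>i j k. ?occurs i j k" by blast
next
  assume "\<exists>i j k. ?occurs i j k"
  then obtain i j k where occurs: "?occurs i j k" by blast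
  define f where "f m = [i, j, k] ! m" for m
  have f_values: "f 0 = i" "f (Suc 0) = j" "f (Suc (Suc 0)) = k" by (auto simp: f_def)
  have "strict_mono_on {..<length [a, b, c]} f"
    using occurs by (auto simp: strict_mono_on_def less_Suc_eq f_values)
  then show "contains_pattern n p [a, b, c]"
    unfolding contains_pattern_def using occurs
    by (intro exI[of _ f]) (auto simp: All_less_Suc f_values)
qed

lemma avoids_123_iff:
  "avoids_pattern n p [1, 2, 3] \<longleftrightarrow>
     (\<forall>i j k. 0 < i \<longrightarrow> i < j \<longrightarrow> j < k \<longrightarrow> k \<le> n \<longrightarrow> \<not> (p i < p j \<and> p j < p k))"
proof -
  have "(((1::nat) < 2 \<longleftrightarrow> p i < p j) \<and> ((2::nat) < 1 \<longleftrightarrow> p j < p i) \<and>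
         ((1::nat) < 3 \<longleftrightarrow> p i < p k) \<and> ((3::nat) < 1 \<longleftrightarrow> p k < p i) \<and>
         ((2::nat) < 3 \<longleftrightarrow> p j < p k) \<and> ((3::nat) < 2 \<longleftrightarrow> p k < p j)) \<longleftrightarrow>
        p i < p j \<and> p j < p k" for i j k
    by simp linarith
  then show ?thesis
    unfolding avoids_pattern_def contains_pattern_length_3 by (simp only:) blast
qed

lemma avoids_231_iff:
  "avoids_pattern n p [2, 3, 1] \<longleftrightarrow>
     (\<forall>i j k. 0 < i \<longrightarrow> i < j \<longrightarrow> j < k \<longrightarrow> k \<le> n \<longrightarrow> \<not> (p k < p i \<and> p i < p j))"
proof -
  have "(((2::nat) < 3 \<longleftrightarrow> p i < p j) \<and> ((3::nat) < 2 \<longleftrightarrow> p j < p i) \<and>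
         ((2::nat) < 1 \<longleftrightarrow> p i < p k) \<and> ((1::nat) < 2 \<longleftrightarrow> p k < p i) \<and>
         ((3::nat) < 1 \<longleftrightarrow> p j < p k) \<and> ((1::nat) < 3 \<longleftrightarrow> p k < p j)) \<longleftrightarrow>
        p k < p i \<and> p i < p j" for i j k
    by simp linarith
  then show ?thesis
    unfolding avoids_pattern_def contains_pattern_length_3 by (simp only:) blast
qed

lemma rotated_reversal_ascent:
  assumes "d < N" "0 < i" "i < j" "j \<le> c + N"
    and "rotated_reversal c N d i < rotated_reversal c N d j"
  shows "c < i" "i + d \<le> c + N" "c + N < j + d"
  using assms by (auto simp: rotated_reversal_eq_if split: if_splits)

lemma rotated_reversal_avoids_123:
  assumes "d < N"
  shows "avoids_pattern (c + N) (rotated_reversal c N d) [1, 2, 3]"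
  unfolding avoids_123_iff
proof (intro allI impI notI, elim conjE)
  let ?p = "rotated_reversal c N d"
  fix i j k assume "0 < i" "i < j" "j < k" "k \<le> c + N" "?p i < ?p j" "?p j < ?p k"
  then have "c + N < j + d" "j + d \<le> c + N"
    using rotated_reversal_ascent(3)[OF assms, of i j c]
      rotated_reversal_ascent(2)[OF assms, of j k c]
    by simp_all
  then show False by simp
qed

lemma rotated_reversal_avoids_231:
  assumes "d < N"
  shows "avoids_pattern (c + N) (rotated_reversal c N d) [2, 3, 1]"
  unfolding avoids_231_iff
proof (intro allI impI notI, elim conjE)
  let ?p = "rotated_reversal c N d"
  fix i j k assume order: "0 < i" "i < j" "j < k" "k \<le> c + N" and "?p k < ?p i" "?p i < ?p j"
  then have "c < i" "i + d \<le> c + N" "c + N < k + d"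
    using rotated_reversal_ascent[OF assms, of i j c] by simp_all
  then have "?p i \<le> N - d" "N - d < ?p k"
    using assms order by (simp_all add: rotated_reversal_eq_if)
  then show False using \<open>?p k < ?p i\<close> by simp
qed

lemma permutes_add_card_greater:
  assumes "p permutes {1..n}" "i \<in> {1..n}"
  shows "p i + card {j \<in> {1..n}. p i < p j} = n"
proof -
  have "p ` {j \<in> {1..n}. p i < p j} = {p i<..n}"
  proof
    show "p ` {j \<in> {1..n}. p i < p j} \<subseteq> {p i<..n}"
      using permutes_in_image[OF assms(1)] by fastforce
    show "{p i<..n} \<subseteq> p ` {j \<in> {1..n}. p i < p j}"
    proof
      fix y assume "y \<in> {p i<..n}"
      then have "y \<in> p ` {1..n}" "p i < y" using permutes_image[OF assms(1)] by auto
      then show "y \<in> p ` {j \<in> {1..n}. p i < p j}" by blast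
    qed
  qed
  then have "card {j \<in> {1..n}. p i < p j} = n - p i"
    using card_image[OF permutes_inj_on[OF assms(1)], of "{j \<in> {1..n}. p i < p j}"] by simp
  moreover have "p i \<le> n" using permutes_in_image[OF assms(1), of i] assms(2) by simp
  ultimately show ?thesis by simp
qed

locale avoider =
  fixes n :: nat and p :: "nat \<Rightarrow> nat" and t :: nat
  assumes permutes: "p permutes {1..n}"
    and no_123: "\<lbrakk>0 < i; i < j; j < k; k \<le> n\<rbrakk> \<Longrightarrow> \<not> (p i < p j \<and> p j < p k)"
    and no_231: "\<lbrakk>0 < i; i < j; j < k; k \<le> n\<rbrakk> \<Longrightarrow> \<not> (p k < p i \<and> p i < p j)"
    and position_1: "t \<in> {1..n}" "p t = 1"
begin

lemma p_eq_iff: "p i = p j \<longleftrightarrow> i = j"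
  using permutes_inj[OF permutes] by (auto dest: injD)

lemma p_t_less: "\<lbrakk>0 < i; i \<le> n; i \<noteq> t\<rbrakk> \<Longrightarrow> p t < p i"
  using permutes_in_image[OF permutes, of i] p_eq_iff[of i t] position_1 by auto

lemma decreasing_before:
  assumes "0 < i" "i < j" "j \<le> t"
  shows "p j < p i"
proof (rule ccontr)
  assume "\<not> p j < p i"
  then have "p i < p j" using p_eq_iff[of i j] assms by simp
  moreover have "p t < p i" using p_t_less[of i] assms position_1 by simp
  moreover from this calculation have "j \<noteq> t" by auto
  ultimately show False using no_231[of i j t] assms position_1 by simp
qed

lemma decreasing_after:
  assumes "t < i" "i < j" "j \<le> n"
  shows "p j < p i"
  using no_123[of t i j] p_t_less[of i] p_eq_iff[of i j] assms position_1 by force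

lemma less_before_iff: "\<lbrakk>i \<in> {1..t}; j \<in> {1..t}\<rbrakk> \<Longrightarrow> p i < p j \<longleftrightarrow> j < i"
  using decreasing_before[of i j] decreasing_before[of j i]
  by (cases i j rule: linorder_cases) auto

lemma less_after_iff: "\<lbrakk>i \<in> {t<..n}; j \<in> {t<..n}\<rbrakk> \<Longrightarrow> p i < p j \<longleftrightarrow> j < i"
  using decreasing_after[of i j] decreasing_after[of j i]
  by (cases i j rule: linorder_cases) auto

lemma below_all_after:
  assumes before: "i \<in> {1..t}" and after: "j \<in> {t<..n}" "p i < p j" "k \<in> {t<..n}"
  shows "p i < p k"
proof (rule ccontr)
  assume "\<not> p i < p k"
  then have "p k < p i" using p_eq_iff[of i k] before after by auto
  moreover from this have "j < k" using after less_after_iff[of k j] by simp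
  ultimately show False using no_231[of i j k] before after by auto
qed

lemma ex_less_across_iff: "\<exists>c<t. \<forall>i\<in>{1..t}. \<forall>j\<in>{t<..n}. p i < p j \<longleftrightarrow> c < i"
proof -
  define below where "below i \<longleftrightarrow> (\<forall>j\<in>{t<..n}. p i < p j)" for i
  define c where "c = (LEAST c. below (Suc c))"
  have "below (Suc (t - 1))" using p_t_less position_1 by (auto simp: below_def)
  then have "below (Suc c)" "c \<le> t - 1"
    unfolding c_def by (rule LeastI, rule Least_le)
  then have "c < t" using position_1 by auto
  have c_less: "c < i" if "below i" "i \<in> {1..t}" for i
    using Least_le[of "\<lambda>c. below (Suc c)" "i - 1"] that by (auto simp flip: c_def)
  have "p i < p j \<longleftrightarrow> c < i" if "i \<in> {1..t}" "j \<in> {t<..n}" for i j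
  proof
    assume "p i < p j"
    then show "c < i" using below_all_after[of i j] that by (intro c_less) (auto simp: below_def)
  next
    assume "c < i"
    then have "p i \<le> p (Suc c)"
      using that less_before_iff[of "Suc c" i] \<open>c < t\<close> by (auto simp flip: not_less)
    also have "\<dots> < p j" using \<open>below (Suc c)\<close> that by (simp add: below_def)
    finally show "p i < p j" .
  qed
  with \<open>c < t\<close> show ?thesis by blast
qed

lemma add_card_greater_split:
  assumes "i \<in> {1..n}"
  shows "p i + (card {j \<in> {1..t}. p i < p j} + card {j \<in> {t<..n}. p i < p j}) = n"
proof -
  have "{j \<in> {1..n}. p i < p j} = {j \<in> {1..t}. p i < p j} \<union> {j \<in> {t<..n}. p i < p j}"
    using position_1 by auto
  moreover have "card \<dots> = card {j \<in> {1..t}. p i < p j} + card {j \<in> {t<..n}. p i < p j}"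
    by (rule card_Un_disjoint) auto
  ultimately show ?thesis
    using permutes_add_card_greater[OF permutes assms] by simp
qed

lemma value_before:
  assumes before: "i \<in> {1..t}" and less_iff: "\<And>j. j \<in> {t<..n} \<Longrightarrow> p i < p j \<longleftrightarrow> c < i"
  shows "p i + (i - 1 + (if c < i then n - t else 0)) = n"
proof -
  have "{j \<in> {1..t}. p i < p j} = {1..<i}"
    using before less_before_iff[OF before] by auto
  moreover have "{j \<in> {t<..n}. p i < p j} = (if c < i then {t<..n} else {})"
    using less_iff by auto
  ultimately show ?thesis
    using add_card_greater_split[of i] before position_1 by (simp split: if_splits)
qed

lemma value_after:
  assumes after: "i \<in> {t<..n}" and "c < t"
    and less_iff: "\<And>j. j \<in> {1..t} \<Longrightarrow> p j < p i \<longleftrightarrow> c < j"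
  shows "p i + (c + (i - t - 1)) = n"
proof -
  have "p i < p j \<longleftrightarrow> j \<le> c" if "j \<in> {1..t}" for j
    using less_iff[OF that] p_eq_iff[of i j] after that by fastforce
  then have "{j \<in> {1..t}. p i < p j} = {1..c}"
    using \<open>c < t\<close> by auto
  moreover have "{j \<in> {t<..n}. p i < p j} = {t<..<i}"
    using after less_after_iff[OF after] by auto
  ultimately show ?thesis
    using add_card_greater_split[of i] after position_1 by simp
qed

lemma eq_rotated_reversal:
  obtains c where "c < t" "p = rotated_reversal c (n - c) (n - t)"
proof -
  obtain c where "c < t"
    and less_iff: "\<And>i j. \<lbrakk>i \<in> {1..t}; j \<in> {t<..n}\<rbrakk> \<Longrightarrow> p i < p j \<longleftrightarrow> c < i"
    using ex_less_across_iff by blast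
  have "p i = rotated_reversal c (n - c) (n - t) i" for i
  proof -
    consider (outside) "i \<notin> {1..n}" | (before) "i \<in> {1..t}" | (after) "i \<in> {t<..n}"
      using position_1 by fastforce
    then show ?thesis
    proof cases
      case outside
      then show ?thesis
        using permutes_not_in[OF permutes outside] \<open>c < t\<close> position_1
        by (auto simp: rotated_reversal_def)
    next
      case before
      then show ?thesis
        using value_before[OF before less_iff[OF before]] \<open>c < t\<close> position_1
        by (auto simp: rotated_reversal_eq_if split: if_splits)
    next
      case after
      then show ?thesis
        using value_after[OF after \<open>c < t\<close> less_iff[OF _ after]] \<open>c < t\<close> position_1
        by (auto simp: rotated_reversal_eq_if)
    qed
  qed
  then show ?thesis using that \<open>c < t\<close> by blast
qed

end

lemma avoids_123_231_imp_rotated_reversal: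
  assumes "p permutes {1..n}" "n > 0"
    and "avoids_pattern n p [1, 2, 3]" "avoids_pattern n p [2, 3, 1]"
  obtains c N d where "c + N = n" "d < N" "p = rotated_reversal c N d"
proof -
  have "1 \<in> p ` {1..n}" using permutes_image[OF assms(1)] assms(2) by simp
  then obtain t where position_1: "t \<in> {1..n}" "p t = 1" by auto
  interpret avoider n p t
    using assms(1) assms(3,4)[unfolded avoids_123_iff avoids_231_iff] position_1
    by unfold_locales blast+
  obtain c where "c < t" "p = rotated_reversal c (n - c) (n - t)"
    using eq_rotated_reversal .
  then show ?thesis using that[of c "n - c" "n - t"] position_1 by auto
qed

text \<open>For \<open>d = 0\<close> the rotated reversal does not depend on how \<open>c + N\<close> is split.\<close>

lemma rotated_reversal_inject:
  assumes "rotated_reversal c N d = rotated_reversal c' N' d'"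
    and "0 < d" "d < N" "0 < d'" "d' < N'" "c + N = c' + N'"
  shows "c = c' \<and> N = N' \<and> d = d'"
proof -
  have at_Suc_c: "rotated_reversal c N d (c + 1) = N - d" if "d < N" for c N d
    using that rotated_reversal_high[of 0 N c d] by (simp add: rotate_below_def)
  have not_less: "\<not> c < c'"
    if "rotated_reversal c N d = rotated_reversal c' N' d'" "0 < d" "d < N" "c + N = c' + N'"
    for c N d c' N' d'
  proof
    assume "c < c'"
    then have "rotated_reversal c' N' d' (c + 1) = N"
      using that(4) by (simp add: rotated_reversal_low)
    then show False using at_Suc_c[of d N c] that by simp
  qed
  have "c = c'"
    using not_less[OF assms(1)] not_less[OF assms(1)[symmetric]] assms by simp
  moreover from this have "N = N'" using assms by simp
  ultimately have "N - d = N - d'"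
    using at_Suc_c[of d N c] at_Suc_c[of d' N c] assms by simp
  then show ?thesis using \<open>c = c'\<close> \<open>N = N'\<close> assms by simp
qed

section \<open>Counting the cyclic avoiders\<close>

text \<open>With \<open>c = n - N\<close>, the three equations say that \<open>N - c\<close> is 0, 1 and 2.\<close>

definition cyclic_params :: "nat \<Rightarrow> (nat \<times> nat) set" where
  "cyclic_params n = {(N, d). d < N \<and>
     ((2 * N = n \<or> 2 * N = n + 1) \<and> coprime d N \<or> 2 * N = n + 2 \<and> gcd d N = 2)}"

lemma cyclic_params_pos:
  assumes "n > 2" "(N, d) \<in> cyclic_params n"
  shows "0 < d"
  using assms by (cases "d = 0") (auto simp: cyclic_params_def)

lemma cyclic_avoiders_eq:
  assumes "n > 2"
  shows "{p. cyclic_permutation n p \<and> (\<forall>q\<in>{[1,2,3], [2,3,1]}. avoids_pattern n p q)} =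
    (\<lambda>(N, d). rotated_reversal (n - N) N d) ` cyclic_params n"
    (is "?avoiders = ?f ` _")
proof (intro equalityI subsetI)
  fix p assume "p \<in> ?avoiders"
  then have avoider: "p permutes {1..n}" "cyclic_on p {1..n}"
    "avoids_pattern n p [1,2,3]" "avoids_pattern n p [2,3,1]"
    by (auto simp: cyclic_permutation_def)
  moreover have "n > 0" using assms by simp
  ultimately obtain c N d where param: "c + N = n" "d < N" "p = rotated_reversal c N d"
    using avoids_123_231_imp_rotated_reversal by blast
  then have "(N = c \<or> N = c + 1) \<and> coprime d N \<or> N = c + 2 \<and> gcd d N = 2"
    using cyclic_on_rotated_reversal_iff[of d N c] avoider(2) assms by simp
  then have "(N, d) \<in> cyclic_params n"
    using param by (auto simp: cyclic_params_def)
  moreover have "p = ?f (N, d)" using param by auto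
  ultimately show "p \<in> ?f ` cyclic_params n" by blast
next
  fix p assume "p \<in> ?f ` cyclic_params n"
  then obtain N d where param: "(N, d) \<in> cyclic_params n"
    and p_eq: "p = rotated_reversal (n - N) N d"
    by auto
  define c where "c = n - N"
  have "d < N" "c + N = n" using param assms by (auto simp: cyclic_params_def c_def)
  moreover from this have "cyclic_on p {1..c + N}"
    using param assms cyclic_on_rotated_reversal_iff[of d N c]
    by (auto simp: cyclic_params_def p_eq simp flip: c_def)
  ultimately show "p \<in> ?avoiders"
    using rotated_reversal_permutes[of d N c] rotated_reversal_avoids_123[of d N c]
      rotated_reversal_avoids_231[of d N c]
    by (simp add: cyclic_permutation_def p_eq flip: c_def)
qed

lemma num_cyclic_avoiding_eq_card_cyclic_params:
  assumes "n > 2"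
  shows "num_cyclic_avoiding n {[1,2,3], [2,3,1]} = card (cyclic_params n)"
proof -
  have "inj_on (\<lambda>(N, d). rotated_reversal (n - N) N d) (cyclic_params n)"
  proof (rule inj_onI, clarify)
    fix N d N' d'
    assume params: "(N, d) \<in> cyclic_params n" "(N', d') \<in> cyclic_params n"
      and eq: "rotated_reversal (n - N) N d = rotated_reversal (n - N') N' d'"
    have "d < N" "d' < N'" "n - N + N = n - N' + N'"
      using params assms by (auto simp: cyclic_params_def)
    then show "N = N' \<and> d = d'"
      using rotated_reversal_inject[OF eq] cyclic_params_pos[OF assms] params by blast
  qed
  then show ?thesis
    unfolding num_cyclic_avoiding_def cyclic_avoiders_eq[OF assms] by (rule card_image)
qed

lemma totatives_eq_less: "N > 1 \<Longrightarrow> totatives N = {d. d < N \<and> coprime d N}"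
  by (auto simp: totatives_def intro: le_neq_trans gr0I)

lemma card_cyclic_params_odd:
  assumes "m > 1"
  shows "card (cyclic_params (2 * m - 1)) = totient m"
proof -
  have "2 * N \<noteq> 2 * m - 1" "2 * N = 2 * m - 1 + 1 \<longleftrightarrow> N = m" "2 * N \<noteq> 2 * m - 1 + 2" for N
    using assms by presburger+
  then have "cyclic_params (2 * m - 1) = {m} \<times> totatives m"
    unfolding cyclic_params_def totatives_eq_less[OF assms] by auto
  then show ?thesis by (simp add: totient_def card_cartesian_product)
qed

lemma card_cyclic_params_even:
  assumes "m > 1"
  shows "card (cyclic_params (2 * m)) =
    totient m + (if odd m then totient ((m + 1) div 2) else 0)"
proof -
  let ?D = "{d \<in> {0<..m + 1}. gcd d (m + 1) = 2}"
  have "2 * N = 2 * m \<longleftrightarrow> N = m" "2 * N \<noteq> 2 * m + 1" "2 * N = 2 * m + 2 \<longleftrightarrow> N = m + 1" for N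
    by presburger+
  moreover have "?D = {d. d < m + 1 \<and> gcd d (m + 1) = 2}"
    using assms by (auto intro: le_neq_trans gr0I)
  ultimately have "cyclic_params (2 * m) = {m} \<times> totatives m \<union> {m + 1} \<times> ?D"
    unfolding cyclic_params_def totatives_eq_less[OF assms] by auto
  then have "card (cyclic_params (2 * m)) = totient m + card ?D"
    by (simp add: card_Un_disjoint disjoint_iff totient_def card_cartesian_product_singleton)
  also have "card ?D = (if odd m then totient ((m + 1) div 2) else 0)"
  proof (cases "odd m")
    case True
    then show ?thesis using card_gcd_eq_totient[of "m + 1" 2] by simp
  next
    case False
    then have "\<not> 2 dvd m + 1" by simp
    then have "gcd d (m + 1) \<noteq> 2" for d by (metis gcd_dvd2)
    then show ?thesis using False by simp
  qed
  finally show ?thesis .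
qed

theorem theorem18:
  fixes n :: nat
  assumes "n > 2"
  shows "(\<forall>k>0. n = 4 * k \<longrightarrow>
            num_cyclic_avoiding n {[1,2,3], [2,3,1]} = totient (2 * k) \<and>
            totient (2 * k) = totient (n div 2)) \<and>
         (\<forall>k>0. n = 4 * k + 2 \<longrightarrow>
            num_cyclic_avoiding n {[1,2,3], [2,3,1]} = totient (k + 1) + totient (2 * k + 1) \<and>
            totient (k + 1) + totient (2 * k + 1) = totient ((n + 2) div 4) + totient (n div 2)) \<and>
         (\<forall>m>0. n = 2 * m - 1 \<longrightarrow>
            num_cyclic_avoiding n {[1,2,3], [2,3,1]} = totient m \<and>
            totient m = totient ((n + 1) div 2))"
  unfolding num_cyclic_avoiding_eq_card_cyclic_params[OF assms]
proof (intro conjI allI impI)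
  fix k :: nat assume "k > 0" "n = 4 * k"
  then show "card (cyclic_params n) = totient (2 * k)" "totient (2 * k) = totient (n div 2)"
    using card_cyclic_params_even[of "2 * k"] by simp_all
next
  fix k :: nat assume "k > 0" and n: "n = 4 * k + 2"
  then show "card (cyclic_params n) = totient (k + 1) + totient (2 * k + 1)"
    using card_cyclic_params_even[of "2 * k + 1"] by simp
  have "(n + 2) div 4 = k + 1" "n div 2 = 2 * k + 1" using n by auto
  then show "totient (k + 1) + totient (2 * k + 1) = totient ((n + 2) div 4) + totient (n div 2)"
    by simp
next
  fix m :: nat assume "m > 0" and n: "n = 2 * m - 1"
  then show "card (cyclic_params n) = totient m"
    using card_cyclic_params_odd[of m] assms by simp
  have "(n + 1) div 2 = m" using n \<open>m > 0\<close> by auto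
  then show "totient m = totient ((n + 1) div 2)" by simp
qed

end
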